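(* Fix $0<c<1$ and a fixed integer $s\ge1$. For each $n$, let $\Gamma_n$ be a group of order $n$ and $h_n$ an integer with $h_n/n\ge c$, let $H_n$ be chosen uniformly at random among all $h_n$-element subsets of $\Gamma_n$, and let $G_n=\mathrm{Cay}(\Gamma_n,H_n)$. Then $\Pr\big(d_{s1}(G_n)\le 2\big)\to 1$ as $n\to\infty$.
   Context: The Cayley digraph $\mathrm{Cay}(\Gamma,H)$ has vertex set $\Gamma$ and an edge from $x$ to $y$ whenever $y=hx$ for some $h\in H$ (loops allowed). Activation process: given a digraph with vertex set $V$, a set $S\subseteq V$ and threshold $t$, put $S_0=S$ and $S_i=S_{i-1}\cup\{v\notin S_{i-1}: v \text{ has at least } t \text{ edges } (u,v) \text{ with } u\in S_{i-1}\}$ for $i\ge1$. $d(S,t)$ is the smallest $i$ with $S_i=V$ ($\infty$ if none exists), and $d_{st}(G)=\max\{d(S,t): S\subseteq V,\ |S|=s\}$; in particular $d_{11}$ is the ordinary diameter. *)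

theory Defs
  imports "HOL-Probability.Probability" "HOL-Algebra.Coset" "HOL-Library.Extended_Nat"
    "Graph_Theory.Digraph"
begin

text \<open>The arc \<open>(x, y)\<close> runs from \<open>x\<close> to \<open>y\<close>; loops occur exactly when \<open>H\<close> contains the unit.\<close>

definition Cay :: "('a, 'b) monoid_scheme \<Rightarrow> 'a set \<Rightarrow> ('a, 'a \<times> 'a) pre_digraph" where
  "Cay \<Gamma> H = \<lparr> verts = carrier \<Gamma>,
                arcs = {(x, y). x \<in> carrier \<Gamma> \<and> y \<in> carrier \<Gamma> \<and> (\<exists>h\<in>H. y = h \<otimes>\<^bsub>\<Gamma>\<^esub> x)},
                tail = fst, head = snd \<rparr>"

text \<open>The threshold counts arcs with \<^const>\<open>card\<close>, so the definition is only meant for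
  digraphs in which every vertex has finite in-degree.\<close>

primrec active :: "('a, 'e) pre_digraph \<Rightarrow> nat \<Rightarrow> 'a set \<Rightarrow> nat \<Rightarrow> 'a set" where
  "active G t S 0 = S"
| "active G t S (Suc i) = active G t S i \<union>
     {v \<in> verts G. v \<notin> active G t S i \<and>
        t \<le> card {e \<in> arcs G. tail G e \<in> active G t S i \<and> head G e = v}}"

text \<open>The infimum of the empty set in \<^typ>\<open>enat\<close> is \<open>\<infinity>\<close>.\<close>

definition activation_time :: "('a, 'e) pre_digraph \<Rightarrow> 'a set \<Rightarrow> nat \<Rightarrow> enat" where
  "activation_time G S t = (INF i\<in>{i. active G t S i = verts G}. enat i)"

text \<open>For a finite digraph with at least \<open>s\<close> vertices the supremum is a maximum. If there are
  fewer than \<open>s\<close> vertices, it is \<open>0\<close> by convention.\<close>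

definition st_diameter :: "nat \<Rightarrow> nat \<Rightarrow> ('a, 'e) pre_digraph \<Rightarrow> enat" where
  "st_diameter s t G =
     (SUP S\<in>{S. S \<subseteq> verts G \<and> finite S \<and> card S = s}. activation_time G S t)"

end

theory Submission
  imports Defs
begin

text \<open>If every group element is a product of two elements of \<open>H\<close>, then any nonempty seed set
  activates everything in two steps. A fixed \<open>g\<close> fails to be such a product exactly when \<open>H\<close> is
  disjoint from its image under the permutation \<open>x \<mapsto> g x\<^sup>-\<^sup>1\<close>. Greedily one finds linearly many
  disjoint pairs none of which may then be contained in \<open>H\<close>; exposing the pairs one at a time
  shows that this is exponentially unlikely, which beats the union bound over the \<open>n\<close> choices
  of \<open>g\<close>.\<close>

section \<open>Disjoint pairs containing a point and its image\<close>

text \<open>Greedy choice: m disjoint pairs cover at most 2m points, and injectivity of f gives at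
  most 2m further points whose image is covered. So fewer than 4(m + 1) points are blocked, and a
  fresh a with fresh image f a remains.\<close>

lemma exists_disjoint_pairs:
  assumes "finite V" "inj_on f V" "f ` V \<subseteq> V" "4 * m \<le> card V"
  shows "\<exists>M. finite M \<and> card M = m \<and> disjoint M \<and>
           (\<forall>P\<in>M. P \<subseteq> V \<and> card P = 2 \<and> (\<exists>a\<in>P. f a \<in> P))"
  using assms(4)
proof (induction m)
  case 0
  show ?case by (intro exI[of _ "{}"]) auto
next
  case (Suc m)
  then obtain M where M: "finite M" "card M = m" "disjoint M"
    "\<And>P. P \<in> M \<Longrightarrow> P \<subseteq> V \<and> card P = 2 \<and> (\<exists>a\<in>P. f a \<in> P)"
    by auto
  let ?W = "\<Union>M"
  have cW: "card ?W \<le> 2 * m"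
    using card_Union_le_sum_card[of M] M(2,4) by simp
  have finW: "finite ?W"
    using M(4) \<open>finite V\<close> by (meson Sup_least finite_subset)
  have "card (f -` ?W \<inter> V) \<le> card ?W"
    using finW assms(2) by (intro card_vimage_inj_on_le) auto
  then have "card (?W \<union> (f -` ?W \<inter> V)) \<le> 4 * m"
    using cW card_Un_le[of ?W "f -` ?W \<inter> V"] by linarith
  then have "\<not> V \<subseteq> ?W \<union> (f -` ?W \<inter> V)"
    using Suc.prems card_mono[of "?W \<union> (f -` ?W \<inter> V)" V] finW assms(1) by fastforce
  then obtain a where a: "a \<in> V" "a \<notin> ?W" "f a \<notin> ?W" by blast
  have "card (insert a ?W) \<le> 2 * m + 1"
    using cW finW a by simp
  then have "\<not> V \<subseteq> insert a ?W"
    using Suc.prems card_mono[of "insert a ?W" V] finW by fastforce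
  then obtain b where b: "b \<in> V" "b \<notin> ?W" "b \<noteq> a" by auto
  \<comment> \<open>A fixed point of f would only give a singleton, so it is padded with another
    fresh point b; the pair still contains both a and f a.\<close>
  define P where "P = (if f a = a then {a, b} else {a, f a})"
  have P: "P \<subseteq> V" "card P = 2" "a \<in> P" "f a \<in> P" "P \<inter> ?W = {}"
    using a b assms(3) by (auto simp: P_def)
  have "P \<notin> M" using P(3) a(2) by auto
  moreover have "disjoint (insert P M)"
    using M(3) P(5) by (auto simp: pairwise_insert disjnt_def)
  ultimately show ?case
    using M P by (intro exI[of _ "insert P M"]) auto
qed

section \<open>Counting k-subsets that contain none of the given pairs\<close>

text \<open>A fixed pair lies in a proportion k(k - 1) / (v(v - 1)) of the k-subsets of a v-set. The
  bounds r and N replace k and v so that a single \<open>\<delta>\<close> serves while both shrink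
  during the later induction.\<close>

lemma choose_minus_two_ge:
  fixes \<delta> :: real
  assumes "v \<ge> 2" "r < k" "v \<le> N" "\<delta> * (real N)\<^sup>2 \<le> (real r)\<^sup>2" "0 \<le> \<delta>"
  shows "\<delta> * real (v choose k) \<le> real ((v - 2) choose (k - 2))"
proof (cases "r = 0")
  \<comment> \<open>Here \<open>\<delta>\<close> must vanish. Treating this case apart leaves k
    \<ge> 2, so that \<open>k - 2\<close> is not truncated.\<close>
  case True
  then have "\<delta> * (real N)\<^sup>2 = 0" using assms(4,5) by (intro order_antisym) auto
  then have "\<delta> = 0" using assms(1,3) by auto
  then show ?thesis by simp
next
  case False
  obtain v' k' where vk: "v = Suc (Suc v')" "k = Suc (Suc k')"
    using that[of "v - 2" "k - 2"] assms(1,2) False by simp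
  have "k * (k - 1) * (v choose k) = (k - 1) * ((v choose k) * k)"
    by (simp only: mult_ac)
  also have "\<dots> = v * (((v - 1) choose (k - 1)) * (k - 1))"
    using Suc_times_binomial_eq[of "Suc v'" "Suc k'"] unfolding vk diff_Suc_1
    by (metis mult.left_commute mult.commute)
  also have "\<dots> = v * (v - 1) * ((v - 2) choose (k - 2))"
    using Suc_times_binomial_eq[of v' k'] unfolding vk by (simp del: binomial_Suc_Suc mult_Suc mult_Suc_right)
  finally have eq: "k * (k - 1) * (v choose k) = v * (v - 1) * ((v - 2) choose (k - 2))" .
  have "\<delta> * (real v)\<^sup>2 \<le> \<delta> * (real N)\<^sup>2"
    using assms by (intro mult_left_mono power_mono) auto
  also have "\<dots> \<le> (real r)\<^sup>2" by fact
  \<comment> \<open>Both factors k and k - 1 are at least r, because \<open>r < k\<close>.\<close>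
  also have "\<dots> \<le> real (k * (k - 1))"
    unfolding of_nat_power[symmetric] of_nat_le_iff unfolding power2_eq_square
    using assms(2) by (intro mult_mono) auto
  finally have "(\<delta> * (real v)\<^sup>2) * real (v choose k) \<le> real (k * (k - 1)) * real (v choose k)"
    by (intro mult_right_mono) auto
  also have "\<dots> = real (v * (v - 1) * ((v - 2) choose (k - 2)))"
    unfolding of_nat_mult[symmetric] eq ..
  also have "\<dots> \<le> (real v)\<^sup>2 * real ((v - 2) choose (k - 2))"
    unfolding of_nat_power[symmetric] of_nat_mult[symmetric] of_nat_le_iff unfolding power2_eq_square
    by (intro mult_mono) auto
  finally have "(real v)\<^sup>2 * (\<delta> * real (v choose k)) \<le> (real v)\<^sup>2 * real ((v - 2) choose (k - 2))"
    by (simp add: mult_ac)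
  then show ?thesis using assms(1) by (subst (asm) mult_le_cancel_left_pos) auto
qed

lemma choose_split_two:
  assumes "v \<ge> 2" "k \<ge> 2"
  shows "(v choose k) = ((v - 2) choose k) + 2 * ((v - 2) choose (k - 1)) + ((v - 2) choose (k - 2))"
proof -
  obtain v' k' where "v = Suc (Suc v')" "k = Suc (Suc k')"
    using that[of "v - 2" "k - 2"] assms by simp
  then show ?thesis by simp
qed

text \<open>Exposing one pair {a, b} at a time: a set not containing it meets it in at most one
  point, and the rest is a subset of V - {a, b} of size k or k - 1 that avoids the other pairs. Each
  pair thus costs a factor 1 - \<open>\<delta>\<close>. The invariant
  \<open>card M + r \<le> k\<close> survives because at most one element is used up per
  pair.\<close>

lemma card_subsets_avoiding_pairs_le:
  fixes \<delta> :: real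
  assumes "finite M" "finite V" "disjoint M" "\<And>P. P \<in> M \<Longrightarrow> P \<subseteq> V \<and> card P = 2"
    and "card M + r \<le> k" "card V \<le> N" "\<delta> * (real N)\<^sup>2 \<le> (real r)\<^sup>2" "0 \<le> \<delta>" "\<delta> \<le> 1" "1 \<le> r"
  shows "real (card {H. H \<subseteq> V \<and> card H = k \<and> (\<forall>P\<in>M. \<not> P \<subseteq> H)})
           \<le> (1 - \<delta>) ^ card M * real (card V choose k)"
  using assms(1-6)
proof (induction M arbitrary: V k rule: finite_induct)
  case empty
  then show ?case by (simp add: n_subsets)
next
  case (insert P M)
  obtain a b where ab: "P = {a, b}" "a \<noteq> b"
    using insert.prems(3)[of P] by (auto simp: card_2_iff)
  have abV: "a \<in> V" "b \<in> V" using insert.prems(3)[of P] ab by auto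
  let ?V = "V - P"
  let ?F = "\<lambda>k. {H. H \<subseteq> ?V \<and> card H = k \<and> (\<forall>Q\<in>M. \<not> Q \<subseteq> H)}"
  have fin: "finite (?F j)" for j
    by (rule finite_subset[of _ "Pow ?V"]) (use insert.prems(1) in auto)
  have disj: "disjoint M" and dP: "\<And>Q. Q \<in> M \<Longrightarrow> Q \<inter> P = {}"
    using insert.prems(2) insert.hyps(2) unfolding pairwise_insert disjnt_def by auto
  have MV: "Q \<subseteq> ?V \<and> card Q = 2" if "Q \<in> M" for Q
    using insert.prems(3)[of Q] dP[OF that] that by auto
  have cV: "card ?V = card V - 2"
    using insert.prems(1) abV by (subst card_Diff_subset) (auto simp: ab)
  have v2: "card V \<ge> 2"
    using insert.prems(1) insert.prems(3)[of P] card_mono[of V P] by auto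
  have k: "card M + r + 1 \<le> k" using insert.prems(4) insert.hyps by simp
  have "{H. H \<subseteq> V \<and> card H = k \<and> (\<forall>P\<in>insert P M. \<not> P \<subseteq> H)}
          \<subseteq> ?F k \<union> (insert a ` ?F (k - 1) \<union> insert b ` ?F (k - 1))" (is "?L \<subseteq> _")
  proof
    fix H assume "H \<in> ?L"
    then have H: "H \<subseteq> V" "card H = k" "\<not> P \<subseteq> H" "\<And>Q. Q \<in> M \<Longrightarrow> \<not> Q \<subseteq> H" by auto
    have finH: "finite H" using H(1) insert.prems(1) by (rule finite_subset)
    have aux: "H - {x} \<in> ?F (k - 1)" "H = insert x (H - {x})"
      if "x \<in> H" "H - {x} \<subseteq> ?V" for x
      using that H finH by auto
    consider "a \<notin> H" "b \<notin> H" | "a \<in> H" "b \<notin> H" | "a \<notin> H" "b \<in> H"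
      using H(3) ab by auto
    then show "H \<in> ?F k \<union> (insert a ` ?F (k - 1) \<union> insert b ` ?F (k - 1))"
    proof cases
      case 1
      then show ?thesis using H ab by auto
    next
      case 2
      then have "H - {a} \<subseteq> ?V" using H ab by auto
      from aux[OF 2(1) this] show ?thesis by blast
    next
      case 3
      then have "H - {b} \<subseteq> ?V" using H ab by auto
      from aux[OF 3(2) this] show ?thesis by blast
    qed
  qed
  then have "card ?L \<le> card (?F k \<union> (insert a ` ?F (k - 1) \<union> insert b ` ?F (k - 1)))"
    using fin by (intro card_mono) auto
  also have "\<dots> \<le> card (?F k) + (card (?F (k - 1)) + card (?F (k - 1)))"
    using fin by (intro order_trans[OF card_Un_le] add_mono card_image_le order_refl)
  finally have "real (card ?L) \<le> real (card (?F k)) + 2 * real (card (?F (k - 1)))"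
    by linarith
  also have "\<dots> \<le> (1 - \<delta>) ^ card M * real (card ?V choose k)
      + 2 * ((1 - \<delta>) ^ card M * real (card ?V choose (k - 1)))"
    using insert.prems(1,5) k cV
    by (intro add_mono mult_left_mono insert.IH disj MV) auto
  also have "\<dots> = (1 - \<delta>) ^ card M * (real ((card V - 2) choose k)
      + 2 * real ((card V - 2) choose (k - 1)))"
    by (simp add: cV algebra_simps)
  \<comment> \<open>The missing term of the split counts the sets containing both points of P. The
    split needs k \<ge> 2, which follows from 1 \<le> r.\<close>
  also have "\<dots> = (1 - \<delta>) ^ card M * (real (card V choose k) - real ((card V - 2) choose (k - 2)))"
    using choose_split_two[OF v2, of k] k assms(10) by simp
  also have "\<dots> \<le> (1 - \<delta>) ^ card M * (real (card V choose k) - \<delta> * real (card V choose k))"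
    using choose_minus_two_ge[OF v2, of r k N \<delta>] k insert.prems(5) assms(7-9)
    by (intro mult_left_mono) auto
  also have "\<dots> = (1 - \<delta>) ^ card (insert P M) * real (card V choose k)"
    using insert.hyps by (simp add: algebra_simps)
  finally show ?case .
qed

section \<open>Activation in Cayley digraphs with threshold one\<close>

lemma active_step:
  assumes "(u, v) \<in> arcs (Cay G H)" "u \<in> active (Cay G H) 1 S i" "finite (carrier G)"
  shows "v \<in> active (Cay G H) 1 S (Suc i)"
proof (cases "v \<in> active (Cay G H) 1 S i")
  case True
  then show ?thesis by simp
next
  case False
  let ?E = "{e \<in> arcs (Cay G H). tail (Cay G H) e \<in> active (Cay G H) 1 S i \<and> head (Cay G H) e = v}"
  have "?E \<subseteq> carrier G \<times> carrier G" by (auto simp: Cay_def)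
  \<comment> \<open>Finiteness is essential: \<open>card\<close> of an infinite set is 0 and would
    miss the threshold.\<close>
  then have "finite ?E" using assms(3) by (meson finite_SigmaI finite_subset)
  moreover have "(u, v) \<in> ?E" using assms by (auto simp: Cay_def)
  ultimately have "card ?E > 0" unfolding card_gt_0_iff by blast
  moreover have "v \<in> verts (Cay G H)" using assms by (auto simp: Cay_def)
  ultimately show ?thesis using False by (simp add: Suc_le_eq)
qed

lemma active_subset_verts: "S \<subseteq> verts G \<Longrightarrow> active G t S i \<subseteq> verts G"
  by (induction i) auto

text \<open>A single seed x reaches any v in two steps: writing v x^-1 = k h with h and k in H gives
  the path x, h x, k h x = v. The seed exists since s \<ge> 1.\<close>

lemma st_diameter_Cay_le_2:
  fixes G (structure)
  assumes "group G" "finite (carrier G)" "H \<subseteq> carrier G" "1 \<le> s"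
    and prod: "\<And>g. g \<in> carrier G \<Longrightarrow> \<exists>x\<in>H. g \<otimes> inv x \<in> H"
  shows "st_diameter s 1 (Cay G H) \<le> 2"
  unfolding st_diameter_def
proof (rule SUP_least)
  interpret group G by fact
  fix S assume "S \<in> {S. S \<subseteq> verts (Cay G H) \<and> finite S \<and> card S = s}"
  then have S: "S \<subseteq> carrier G" "S \<subseteq> verts (Cay G H)" "S \<noteq> {}"
    using assms(4) by (auto simp: Cay_def)
  then obtain x where x: "x \<in> S" "x \<in> carrier G" by auto
  have "v \<in> active (Cay G H) 1 S (Suc (Suc 0))" if v: "v \<in> carrier G" for v
  proof -
    obtain h where h: "h \<in> H" "(v \<otimes> inv x) \<otimes> inv h \<in> H"
      using prod[of "v \<otimes> inv x"] v x by auto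
    have hc: "h \<in> carrier G" using h assms(3) by auto
    have "v \<otimes> inv x \<otimes> inv h \<otimes> (h \<otimes> x) = v"
      using v x hc by (simp add: m_assoc) (simp add: m_assoc[symmetric])
    then have "\<exists>k\<in>H. v = k \<otimes> (h \<otimes> x)" using h(2) by metis
    then have "(x, h \<otimes> x) \<in> arcs (Cay G H)" "(h \<otimes> x, v) \<in> arcs (Cay G H)"
      using h hc x v by (auto simp: Cay_def)
    then show ?thesis
      using x assms(2) by (intro active_step[of "h \<otimes> x"] active_step[of x]) auto
  qed
  then have "active (Cay G H) 1 S 2 = verts (Cay G H)"
    using active_subset_verts[OF S(2), of 1 2]
    by (auto simp: Cay_def numeral_2_eq_2 simp del: active.simps)
  then show "activation_time (Cay G H) S 1 \<le> 2"
    unfolding activation_time_def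
    by (intro INF_lower2[of 2]) (auto simp: numeral_eq_enat)
qed

section \<open>Probability that some group element is not a product of two elements of H\<close>

lemma card_subsets_missing_product_le:
  fixes G (structure)
  assumes "group G" "finite (carrier G)" "g \<in> carrier G" "0 < c" "c < 1"
    and "4 * m \<le> order G" "4 * real m \<le> c * real (order G)" "c * real (order G) \<le> real k"
  shows "real (card {H. H \<subseteq> carrier G \<and> card H = k \<and> (\<forall>x\<in>H. g \<otimes> inv x \<notin> H)})
           \<le> (1 - c\<^sup>2 / 4) ^ m * real (order G choose k)"
proof -
  interpret group G by fact
  let ?f = "\<lambda>x. g \<otimes> inv x"
  have inj: "inj_on ?f (carrier G)"
    using assms(3) by (intro inj_onI) (metis Units_eq Units_l_cancel inv_closed inv_inv)
  have "?f ` carrier G \<subseteq> carrier G" using assms(3) by auto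
  with exists_disjoint_pairs[OF assms(2) inj, of m] assms(6)
  obtain M where M: "finite M" "card M = m" "disjoint M"
    "\<And>P. P \<in> M \<Longrightarrow> P \<subseteq> carrier G \<and> card P = 2 \<and> (\<exists>a\<in>P. ?f a \<in> P)"
    by (auto simp: order_def)
  have n: "0 < order G" using assms(2) one_closed by (auto simp: order_def card_gt_0_iff)
  have cn: "0 < c * real (order G)" using n assms(4) by simp
  \<comment> \<open>From 4m \<le> cn \<le> k, with n the group order, at least 3cn/4 elements of H
    remain after m pairs. The weaker bound cn/2 is kept as r = k - m \<ge> (c/2) n, whence
    \<open>\<delta>\<close> = (c/2)^2.\<close>
  have mk: "m \<le> k" "c / 2 * real (order G) \<le> real (k - m)"
    using assms(7,8) cn by (auto simp: of_nat_diff)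
  have "(c / 2 * real (order G))\<^sup>2 \<le> (real (k - m))\<^sup>2"
    using mk cn by (intro power_mono) auto
  then have \<delta>: "c\<^sup>2 / 4 * (real (order G))\<^sup>2 \<le> (real (k - m))\<^sup>2"
    by (simp add: power_mult_distrib power_divide)
  have r: "1 \<le> k - m" using mk(2) cn by (cases "k - m = 0") auto
  have c2: "c\<^sup>2 / 4 \<le> 1" using assms(4,5) power_le_one[of c 2] by simp
  \<comment> \<open>A pair inside H would put some a together with g a^-1 into H.\<close>
  have "{H. H \<subseteq> carrier G \<and> card H = k \<and> (\<forall>x\<in>H. ?f x \<notin> H)}
      \<subseteq> {H. H \<subseteq> carrier G \<and> card H = k \<and> (\<forall>P\<in>M. \<not> P \<subseteq> H)}"
    using M(4) by blast
  then have "card {H. H \<subseteq> carrier G \<and> card H = k \<and> (\<forall>x\<in>H. ?f x \<notin> H)}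
      \<le> card {H. H \<subseteq> carrier G \<and> card H = k \<and> (\<forall>P\<in>M. \<not> P \<subseteq> H)}"
    using assms(2) by (intro card_mono) auto
  also have "real \<dots> \<le> (1 - c\<^sup>2 / 4) ^ card M * real (card (carrier G) choose k)"
    using M mk(1) \<delta> r c2 assms(2)
    by (intro card_subsets_avoiding_pairs_le[where r = "k - m" and N = "order G"])
       (auto simp: order_def)
  finally show ?thesis by (simp add: M(2) order_def)
qed

lemma prob_st_diameter_Cay_ge:
  fixes G (structure)
  assumes "group G" "finite (carrier G)" "0 < c" "c < 1" "1 \<le> s" "k \<le> order G"
    and "4 * m \<le> order G" "4 * real m \<le> c * real (order G)" "c * real (order G) \<le> real k"
  shows "1 - real (order G) * (1 - c\<^sup>2 / 4) ^ m
           \<le> measure_pmf.prob (pmf_of_set {H. H \<subseteq> carrier G \<and> card H = k})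
                {H. st_diameter s 1 (Cay G H) \<le> 2}"
proof -
  let ?S = "{H. H \<subseteq> carrier G \<and> card H = k}"
  let ?A = "{H. st_diameter s 1 (Cay G H) \<le> 2}"
  let ?B = "\<lambda>g. {H. H \<subseteq> carrier G \<and> card H = k \<and> (\<forall>x\<in>H. g \<otimes> inv x \<notin> H)}"
  let ?q = "(1 - c\<^sup>2 / 4) ^ m"
  have finS: "finite ?S" using assms(2) by simp
  have cS: "card ?S = order G choose k" using assms(2) by (simp add: n_subsets order_def)
  \<comment> \<open>\<open>pmf_of_set\<close> is the uniform distribution only on a finite nonempty
    set; k \<le> \<open>order G\<close> makes the sample space nonempty.\<close>
  have posS: "0 < card ?S" unfolding cS using assms(6) by (simp add: zero_less_binomial)
  then have neS: "?S \<noteq> {}" by (metis card.empty less_irrefl)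
  \<comment> \<open>Union bound: a bad H leaves some g without a factorization in H.\<close>
  have "?S - ?A \<subseteq> (\<Union>g\<in>carrier G. ?B g)"
    using st_diameter_Cay_le_2[OF assms(1,2) _ assms(5)] by fastforce
  then have "card (?S - ?A) \<le> card (\<Union>g\<in>carrier G. ?B g)"
    using assms(2) by (intro card_mono) auto
  also have "\<dots> \<le> (\<Sum>g\<in>carrier G. card (?B g))"
    using assms(2) by (rule card_UN_le)
  also have "real \<dots> \<le> (\<Sum>g\<in>carrier G. ?q * real (order G choose k))"
    unfolding of_nat_sum
    using assms by (intro sum_mono card_subsets_missing_product_le) auto
  finally have bad: "real (card (?S - ?A)) \<le> real (order G) * ?q * real (card ?S)"
    by (simp add: order_def cS)
  have "real (card (?S \<inter> ?A)) + real (card (?S - ?A)) = real (card ?S)"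
    unfolding of_nat_add[symmetric] using card_Int_Diff[OF finS, of ?A] by simp
  with bad have "(1 - real (order G) * ?q) * real (card ?S) \<le> real (card (?S \<inter> ?A))"
    by (simp add: algebra_simps)
  then show ?thesis
    using posS by (simp add: measure_pmf_of_set[OF neS finS] pos_le_divide_eq)
qed

section \<open>Passage to the limit\<close>

lemma n_times_power_floor_tendsto_0:
  fixes q d :: real
  assumes "0 < q" "q < 1" "0 < d"
  shows "(\<lambda>n. real n * q ^ nat \<lfloor>d * real n\<rfloor>) \<longlonglongrightarrow> 0"
proof (rule tendsto_sandwich[where f = "\<lambda>_. 0"])
  let ?b = "q powr d"
  have b: "norm ?b < 1" "0 < ?b" using assms powr_less_mono2[of d q 1] by auto
  show "(\<lambda>n. real n * ?b ^ n / q) \<longlonglongrightarrow> 0"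
    using tendsto_divide[OF powser_times_n_limit_0[OF b(1)] tendsto_const[of q]] assms by simp
  show "\<forall>\<^sub>F n in sequentially. real n * q ^ nat \<lfloor>d * real n\<rfloor> \<le> real n * ?b ^ n / q"
  proof (rule always_eventually, rule allI)
    fix n
    have "q ^ nat \<lfloor>d * real n\<rfloor> = q powr real (nat \<lfloor>d * real n\<rfloor>)"
      using assms(1) by (rule powr_realpow[symmetric])
    \<comment> \<open>As q < 1, lowering the exponent to dn - 1, a lower bound for the floor, only
      increases the power. This leaves the geometric sequence with ratio q^d, up to the constant
      1/q.\<close>
    also have "\<dots> \<le> q powr (d * real n - 1)"
      using assms by (intro powr_mono') linarith+
    also have "\<dots> = ?b ^ n / q"
      using assms by (simp add: powr_diff powr_powr powr_realpow[symmetric])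
    finally have "real n * q ^ nat \<lfloor>d * real n\<rfloor> \<le> real n * (?b ^ n / q)"
      by (rule mult_left_mono) simp
    then show "real n * q ^ nat \<lfloor>d * real n\<rfloor> \<le> real n * ?b ^ n / q" by simp
  qed
qed (use assms in auto)

theorem theorem3:
  fixes c :: real and s :: nat
    and \<Gamma> :: "nat \<Rightarrow> ('a, 'b) monoid_scheme" and h :: "nat \<Rightarrow> nat"
  assumes "0 < c" and "c < 1" and "1 \<le> s"
    and "\<And>n. 1 \<le> n \<Longrightarrow> group (\<Gamma> n)"
    and "\<And>n. 1 \<le> n \<Longrightarrow> order (\<Gamma> n) = n"
    and "\<And>n. 1 \<le> n \<Longrightarrow> h n \<le> n"
    and "\<And>n. 1 \<le> n \<Longrightarrow> c \<le> real (h n) / real n"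
  shows "(\<lambda>n. measure_pmf.prob
                (pmf_of_set {H. H \<subseteq> carrier (\<Gamma> n) \<and> card H = h n})
                {H. st_diameter s 1 (Cay (\<Gamma> n) H) \<le> 2})
           \<longlonglongrightarrow> 1"
proof (rule tendsto_sandwich)
  let ?q = "1 - c\<^sup>2 / 4"
  \<comment> \<open>The largest m with 4m \<le> cn. Since c < 1 it also satisfies 4m \<le> n, as the
    choice of disjoint pairs requires, and it grows linearly in n.\<close>
  let ?m = "\<lambda>n. nat \<lfloor>c / 4 * real n\<rfloor>"
  have q: "0 < ?q" "?q < 1"
    using assms(1,2) power_le_one[of c 2] by auto
  show "(\<lambda>n. 1 - real n * ?q ^ ?m n) \<longlonglongrightarrow> 1"
    using tendsto_diff[OF tendsto_const[of 1] n_times_power_floor_tendsto_0[OF q, of "c / 4"]]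
      assms(1) by simp
  show "\<forall>\<^sub>F n in sequentially. 1 - real n * ?q ^ ?m n \<le> measure_pmf.prob
                (pmf_of_set {H. H \<subseteq> carrier (\<Gamma> n) \<and> card H = h n})
                {H. st_diameter s 1 (Cay (\<Gamma> n) H) \<le> 2}"
    using eventually_ge_at_top[of 1]
  proof eventually_elim
    case (elim n)
    have ord: "order (\<Gamma> n) = n" using assms(5) elim by simp
    have fin: "finite (carrier (\<Gamma> n))"
      using ord elim by (intro card_ge_0_finite) (simp add: order_def)
    have "real (?m n) \<le> c / 4 * real n"
      using assms(1) by (intro of_nat_floor) simp
    then have m: "4 * real (?m n) \<le> c * real n" by simp
    moreover have "c * real n \<le> real n" using assms(2) elim by simp
    ultimately have m4: "4 * ?m n \<le> n" by linarith
    have "c * real n \<le> real (h n)" using assms(7)[OF elim] elim by (simp add: field_simps)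
    then show ?case
      using prob_st_diameter_Cay_ge[OF assms(4)[OF elim] fin assms(1-3), of "h n" "?m n"]
        m m4 assms(6)[OF elim] unfolding ord by simp
  qed
qed auto

end
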